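(* Let $\epsilon(\lambda)$ denote the exponential distribution with parameter $\lambda$ and let $b(p)$ denote the Bernoulli distribution with parameter $p$. Let $X=A-1$ and $Y=2\varpi B-1$, where $A\sim\epsilon(1)$, $B\sim\epsilon(1)$, $\varpi\sim b(\frac12)$ and $A$, $B$, $\varpi$ are mutually independent. This implies that $X$ and $Y$ are independent. One has $\mathbf{E}(X)=\mathbf{E}(Y)=0$, $\mathbf{E}(X^2)=1$ and $\mathbf{E}(Y^2)=3$. Let also $Z=X+Y$. Then $X$, $Y$ and $Z$ match every condition of the Cramér theorem for multiple integrals recalled in the context, but $X$ and $Y$ are not multiple stochastic integrals in a fixed Wiener chaos. Moreover, $Z\sim F(2)$, but $Y$ is not Gamma distributed.
   Context: The centered Gamma law $F(\nu)$, $\nu>0$, is the law of $2G(\nu/2)-\nu$, where $G(\nu/2)$ has the Gamma law with density $\frac{x^{\nu/2-1}e^{-x}}{\Gamma(\nu/2)}\mathbf{1}_{(0,\infty)}(x)$; its characteristic function is $\lambda\mapsto\left(\frac{e^{-i\lambda}}{\sqrt{1-2i\lambda}}\right)^{\nu}$. For a Wiener process $W$ indexed by $T$ and $f\in L^2(T^q)$, $I_q(f)$ denotes the multiple Wiener–Itô integral of order $q$ of $f$ with respect to $W$ (with $\mathbf{E}(I_q(f)^2)=q!\|f\|^2_{L^2(T^q)}$ for symmetric $f$); the variables $I_q(f)$ form the Wiener chaos of order $q$. The Cramér theorem for multiple integrals states: let $Z=X+Y=I_{q_1}(f)+I_{q_2}(h)$ with $X=I_{q_1}(f)$, $Y=I_{q_2}(h)$,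 $q_1,q_2\ge2$, and $f\in L^2(T^{q_1})$, $h\in L^2(T^{q_2})$ symmetric, be such that $X$ and $Y$ are independent and $\mathbf{E}(Z^2)=2\nu$, $\mathbf{E}(X^2)=q_1!\|f\|^2_{L^2(T^{q_1})}=2\nu_1$, $\mathbf{E}(Y^2)=q_2!\|h\|^2_{L^2(T^{q_2})}=2\nu_2$ with $\nu=\nu_1+\nu_2$, and assume that $Z\sim F(\nu)$; then $X\sim F(\nu_1)$ and $Y\sim F(\nu_2)$. *)

theory Defs
  imports "HOL-Probability.Probability"
begin

definition gamma_density :: "real \<Rightarrow> real \<Rightarrow> real" where
  "gamma_density a x = (if x > 0 then x powr (a - 1) * exp (- x) / Gamma a else 0)"

definition gamma_law :: "real \<Rightarrow> real measure" where
  "gamma_law a = density lborel (\<lambda>x. ennreal (gamma_density a x))"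

definition centered_gamma_law :: "real \<Rightarrow> real measure" where
  "centered_gamma_law \<nu> = distr (gamma_law (\<nu> / 2)) borel (\<lambda>x. 2 * x - \<nu>)"

text \<open>
  The time set \<open>T\<close> is an arbitrary interval of nonnegative reals containing 0,
  such as \<open>[0,1]\<close> or \<open>[0,\<infinity>)\<close>.
\<close>

definition wiener_process :: "'a measure \<Rightarrow> real set \<Rightarrow> (real \<Rightarrow> 'a \<Rightarrow> real) \<Rightarrow> bool" where
  "wiener_process M T W \<longleftrightarrow>
     prob_space M \<and> is_interval T \<and> 0 \<in> T \<and> T \<subseteq> {0..} \<and>
     (\<forall>t\<in>T. W t \<in> borel_measurable M) \<and>
     (AE \<omega> in M. W 0 \<omega> = 0) \<and>
     (\<forall>s\<in>T. \<forall>t\<in>T. s < t \<longrightarrow>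
        distributed M lborel (\<lambda>\<omega>. W t \<omega> - W s \<omega>) (normal_density 0 (sqrt (t - s)))) \<and>
     (\<forall>(n::nat) u. (\<forall>i\<le>n. u i \<in> T) \<and> (\<forall>i<n. u i < u (Suc i)) \<longrightarrow>
        prob_space.indep_vars M (\<lambda>_. borel) (\<lambda>i \<omega>. W (u (Suc i)) \<omega> - W (u i) \<omega>) {..<n}) \<and>
     (AE \<omega> in M. continuous_on T (\<lambda>t. W t \<omega>))"

text \<open>Lebesgue measure on \<open>T\<^sup>q\<close>, whose points are the functions \<open>{..<q} \<rightarrow>\<^sub>E T\<close>.\<close>

definition time_power :: "real set \<Rightarrow> nat \<Rightarrow> (nat \<Rightarrow> real) measure" where
  "time_power T q = PiM {..<q} (\<lambda>_. restrict_space lborel T)"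

text \<open>
  Elementary kernels vanishing on the diagonals. A tuple \<open>(n, t, a)\<close> stands for the points
  \<open>t 0 < \<dots> < t n\<close> of \<open>T\<close> and a coefficient \<open>a k\<close> for every \<open>q\<close>-tuple \<open>k\<close> of pairwise distinct
  cell numbers below \<open>n\<close>; cell number \<open>i\<close> is the interval \<open>(t i, t (i+1)]\<close>.
\<close>

type_synonym elementary_data = "nat \<times> (nat \<Rightarrow> real) \<times> ((nat \<Rightarrow> nat) \<Rightarrow> real)"

definition offdiagonal_indices :: "nat \<Rightarrow> nat \<Rightarrow> (nat \<Rightarrow> nat) set" where
  "offdiagonal_indices q n = {k \<in> {..<q} \<rightarrow>\<^sub>E {..<n}. inj_on k {..<q}}"

fun elementary_on :: "real set \<Rightarrow> elementary_data \<Rightarrow> bool" where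
  "elementary_on T (n, t, a) \<longleftrightarrow> (\<forall>i\<le>n. t i \<in> T) \<and> (\<forall>i<n. t i < t (Suc i))"

fun elementary_kernel :: "nat \<Rightarrow> elementary_data \<Rightarrow> (nat \<Rightarrow> real) \<Rightarrow> real" where
  "elementary_kernel q (n, t, a) x =
     (\<Sum>k\<in>offdiagonal_indices q n. a k * (\<Prod>j<q. indicator {t (k j)<..t (Suc (k j))} (x j)))"

fun elementary_integral ::
    "(real \<Rightarrow> 'a \<Rightarrow> real) \<Rightarrow> nat \<Rightarrow> elementary_data \<Rightarrow> 'a \<Rightarrow> real" where
  "elementary_integral W q (n, t, a) \<omega> =
     (\<Sum>k\<in>offdiagonal_indices q n. a k * (\<Prod>j<q. W (t (Suc (k j))) \<omega> - W (t (k j)) \<omega>))"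

definition L2_kernel :: "real set \<Rightarrow> nat \<Rightarrow> ((nat \<Rightarrow> real) \<Rightarrow> real) \<Rightarrow> bool" where
  "L2_kernel T q f \<longleftrightarrow>
     f \<in> borel_measurable (time_power T q) \<and> integrable (time_power T q) (\<lambda>x. (f x)\<^sup>2)"

text \<open>
  \<open>is_multiple_integral M T W q f F\<close> says that \<open>F\<close> is a version of \<open>I\<^sub>q(f)\<close>. The elementary
  integral is bounded from \<open>L\<^sup>2(T\<^sup>q)\<close> to \<open>L\<^sup>2(M)\<close> and elementary kernels are dense in
  \<open>L\<^sup>2(T\<^sup>q)\<close>, so \<open>F\<close> exists for every \<open>f\<close>, is almost surely unique, and does not depend on the
  approximating sequence. Kernels need not be symmetric: \<open>f\<close> and its symmetrization have the
  same integral.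
\<close>

definition is_multiple_integral ::
    "'a measure \<Rightarrow> real set \<Rightarrow> (real \<Rightarrow> 'a \<Rightarrow> real) \<Rightarrow> nat \<Rightarrow> ((nat \<Rightarrow> real) \<Rightarrow> real)
      \<Rightarrow> ('a \<Rightarrow> real) \<Rightarrow> bool" where
  "is_multiple_integral M T W q f F \<longleftrightarrow>
     L2_kernel T q f \<and> F \<in> borel_measurable M \<and>
     (\<exists>e :: nat \<Rightarrow> elementary_data.
        (\<forall>m. elementary_on T (e m)) \<and>
        (\<lambda>m. \<integral>\<^sup>+x. ennreal ((elementary_kernel q (e m) x - f x)\<^sup>2) \<partial>time_power T q)
          \<longlonglongrightarrow> 0 \<and>
        (\<lambda>m. \<integral>\<^sup>+\<omega>. ennreal ((elementary_integral W q (e m) \<omega> - F \<omega>)\<^sup>2) \<partial>M)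
          \<longlonglongrightarrow> 0)"

definition wiener_chaos ::
    "'a measure \<Rightarrow> real set \<Rightarrow> (real \<Rightarrow> 'a \<Rightarrow> real) \<Rightarrow> nat \<Rightarrow> ('a \<Rightarrow> real) set" where
  "wiener_chaos M T W q = {F. \<exists>f. is_multiple_integral M T W q f F}"

text \<open>
  The hypotheses of the Cramer theorem for multiple integrals on \<open>X\<close>, \<open>Y\<close> and \<open>X + Y\<close>,
  other than that \<open>X\<close> and \<open>Y\<close> are multiple integrals.
\<close>

definition cramer_conditions ::
    "'a measure \<Rightarrow> ('a \<Rightarrow> real) \<Rightarrow> ('a \<Rightarrow> real) \<Rightarrow> real \<Rightarrow> real \<Rightarrow> real \<Rightarrow> bool" where
  "cramer_conditions M X Y \<nu> \<nu>1 \<nu>2 \<longleftrightarrow>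
     \<nu>1 > 0 \<and> \<nu>2 > 0 \<and> \<nu> = \<nu>1 + \<nu>2 \<and>
     prob_space.indep_var M borel X borel Y \<and>
     has_bochner_integral M (\<lambda>\<omega>. (X \<omega> + Y \<omega>)\<^sup>2) (2 * \<nu>) \<and>
     has_bochner_integral M (\<lambda>\<omega>. (X \<omega>)\<^sup>2) (2 * \<nu>1) \<and>
     has_bochner_integral M (\<lambda>\<omega>. (Y \<omega>)\<^sup>2) (2 * \<nu>2) \<and>
     distr M borel (\<lambda>\<omega>. X \<omega> + Y \<omega>) = centered_gamma_law \<nu>"

end

theory Submission imports Defs
begin

text \<open>
  A variable of a Wiener chaos takes a value \<open>c\<close> with probability 0 or 1, whereas \<open>Y\<close> takes
  the value \<open>-1\<close> with probability \<open>1/2\<close>. For the zero-one law, let \<open>P\<close> be an elementary integral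
  of order \<open>q\<close>, that is a polynomial of degree \<open>q\<close> in independent centred Gaussian variables \<open>x\<close>,
  and let \<open>x'\<close> be an independent copy of \<open>x\<close>. The rotated vector
  \<open>x\<^sub>t = ((1 - t\<^sup>2) x + 2 t x') / (1 + t\<^sup>2)\<close> has the law of \<open>x\<close>, and
  \<open>(1 + t\<^sup>2)\<^sup>q (P(x\<^sub>t) - c)\<close> is a polynomial of degree at most \<open>2q\<close> in \<open>t\<close>. If it is small at more
  than \<open>2q\<close> of \<open>N\<close> fixed nodes in \<open>(0,1)\<close> then it is small at \<open>t = 0\<close> and at \<open>t = 1\<close>, where
  \<open>x\<^sub>t\<close> is \<open>x\<close> and \<open>x'\<close>, which are independent. Hence
  \<open>N Pr(\<bar>P - c\<bar> \<le> e) \<le> 2q + N Pr(\<bar>P - c\<bar> \<le> C e)\<^sup>2\<close> with \<open>C\<close> depending on \<open>q\<close> and \<open>N\<close> only,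
  whatever the number of variables. Passing to the \<open>L\<^sup>2\<close> limit, then \<open>e \<rightarrow> 0\<close> and \<open>N \<rightarrow> \<infinity>\<close>, gives
  \<open>p \<le> p\<^sup>2\<close> for \<open>p = Pr(F = c)\<close>.

  For the law of \<open>Z\<close>: \<open>2\<beta>B\<close> is 0 or \<open>2B\<close> with probability \<open>1/2\<close> each, and the densities
  \<open>e\<^sup>-\<^sup>x\<close> of \<open>A\<close> and \<open>e\<^sup>-\<^sup>x\<^sup>/\<^sup>2 - e\<^sup>-\<^sup>x\<close> of \<open>A + 2B\<close> average to that of an exponential
  variable with parameter \<open>1/2\<close>.
\<close>

section \<open>Polynomials that are small at many separated nodes\<close>

text \<open>Induction on the degree: dividing out one node lowers the degree by one and costs a
  factor \<open>1 + 2 / \<delta>\<close>. The constant depends on \<open>d\<close> and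
  \<open>\<delta>\<close> only, never on the coefficients of \<open>Q\<close>; this is what later
  makes the small-ball bound uniform in the number of Gaussian variables.\<close>

lemma poly_bounded_by_nodes:
  fixes R :: "real set"
  assumes "degree Q \<le> d" "finite R" "d < card R" "\<delta> > 0" "R \<subseteq> {0..1}"
    and "\<And>s t. s \<in> R \<Longrightarrow> t \<in> R \<Longrightarrow> s \<noteq> t \<Longrightarrow> \<delta> \<le> \<bar>s - t\<bar>"
    and "\<And>t. t \<in> R \<Longrightarrow> \<bar>poly Q t\<bar> \<le> e" and "x \<in> {0..1}"
  shows "\<bar>poly Q x\<bar> \<le> (1 + 2 / \<delta>) ^ d * e"
  using assms(1-3,5-)
proof (induction d arbitrary: Q R e)
  case 0
  then obtain t where "t \<in> R" by (metis card_gt_0_iff ex_in_conv)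
  moreover obtain a where "Q = [:a:]" using 0 degree_eq_zeroE by blast
  ultimately show ?case using "0.prems"(6)[of t] by simp
next
  case (Suc d)
  note Q = Suc.prems(1) and R = Suc.prems(2-4) and sep = Suc.prems(5)
    and e = Suc.prems(6) and x = Suc.prems(7)
  \<comment> \<open>the difference quotient of \<open>Q\<close> at a node \<open>s\<close> has smaller degree\<close>
  from R obtain s where s: "s \<in> R" by (metis card.empty ex_in_conv not_less0)
  have "poly (Q - [:poly Q s:]) s = 0" by simp
  then obtain P where P: "Q - [:poly Q s:] = [:-s, 1:] * P"
    using poly_eq_0_iff_dvd by blast
  have "degree P \<le> d"
  proof (cases "P = 0")
    case False
    then have "degree (Q - [:poly Q s:]) = Suc (degree P)"
      unfolding P by (subst degree_mult_eq) auto
    moreover have "degree (Q - [:poly Q s:]) \<le> Suc d"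
      using Q by (intro degree_diff_le) auto
    ultimately show ?thesis by simp
  qed simp
  have Pt: "poly Q t = poly Q s + (t - s) * poly P t" for t
  proof -
    have "poly (Q - [:poly Q s:]) t = poly ([:-s, 1:] * P) t" using P by simp
    then show ?thesis by (simp add: algebra_simps)
  qed
  \<comment> \<open>At the remaining nodes the quotient is at most \<open>2 * e / \<delta>\<close>:
    two values of \<open>Q\<close> differ by at most \<open>2 * e\<close>, and two nodes by at least
    \<open>\<delta>\<close>.\<close>
  have "\<bar>poly P x\<bar> \<le> (1 + 2 / \<delta>) ^ d * (2 * e / \<delta>)"
  proof (rule Suc.IH[of _ "R - {s}"])
    fix t assume t: "t \<in> R - {s}"
    have "\<delta> * \<bar>poly P t\<bar> \<le> \<bar>t - s\<bar> * \<bar>poly P t\<bar>"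
      using sep[of t s] t s by (intro mult_right_mono) auto
    also have "\<dots> = \<bar>poly Q t - poly Q s\<bar>" using Pt[of t] by (simp add: abs_mult)
    also have "\<dots> \<le> 2 * e" using e[of t] e[of s] s t by force
    finally show "\<bar>poly P t\<bar> \<le> 2 * e / \<delta>" using \<open>\<delta> > 0\<close> by (simp add: field_simps)
  next
    show "d < card (R - {s})" using R s by (simp add: card_Diff_singleton)
  qed (use \<open>degree P \<le> d\<close> R x sep in auto)
  moreover have "\<bar>poly Q x\<bar> \<le> \<bar>poly Q s\<bar> + \<bar>x - s\<bar> * \<bar>poly P x\<bar>"
    unfolding Pt[of x] by (metis abs_mult abs_triangle_ineq)
  moreover have "\<bar>x - s\<bar> * \<bar>poly P x\<bar> \<le> 1 * \<bar>poly P x\<bar>"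
    using x s R by (intro mult_right_mono) (auto simp: subset_iff abs_le_iff)
  moreover have es: "\<bar>poly Q s\<bar> \<le> e" using e s by auto
  moreover have "1 * e \<le> (1 + 2 / \<delta>) ^ d * e"
    using \<open>\<delta> > 0\<close> es by (intro mult_right_mono one_le_power) auto
  ultimately have "\<bar>poly Q x\<bar> \<le> (1 + 2 / \<delta>) ^ d * e + (1 + 2 / \<delta>) ^ d * (2 * e / \<delta>)"
    by linarith
  then show ?case by (simp add: algebra_simps)
qed

section \<open>Joint laws of independent families and rotation of Gaussian pairs\<close>

text \<open>Serves the empty index set, which occurs for elementary data with \<open>n = 0\<close>;
  there the product space is a single point and any two joint laws agree.\<close>

lemma emeasure_distr_PiM_empty:
  assumes "prob_space K"
  shows "emeasure (distr K (PiM {} (\<lambda>_. borel)) (\<lambda>\<omega>. \<lambda>i\<in>{}. Z i \<omega>)) {\<lambda>_. undefined} = 1"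
proof -
  have "(\<lambda>\<omega>. \<lambda>i\<in>{}. Z i \<omega>) \<in> K \<rightarrow>\<^sub>M PiM {} (\<lambda>_. borel)"
    by (rule measurable_restrict) auto
  from prob_space.emeasure_space_1[OF prob_space.prob_space_distr[OF assms this]]
  show ?thesis by (simp add: space_PiM_empty)
qed

text \<open>Independence makes the joint law the product of the marginals, so the marginals
  determine it. The two families may live on different spaces, which allows Wiener increments to be
  replaced by coordinates of a product space.\<close>

lemma distr_PiM_eq_of_indep:
  assumes "prob_space M" "prob_space N"
    and "prob_space.indep_vars M (\<lambda>_. borel) X I" "prob_space.indep_vars N (\<lambda>_. borel) Y I"
    and "\<And>i. i \<in> I \<Longrightarrow> distr M borel (X i) = distr N borel (Y i)"
  shows "distr M (PiM I (\<lambda>_. borel)) (\<lambda>\<omega>. \<lambda>i\<in>I. X i \<omega>)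
       = distr N (PiM I (\<lambda>_. borel)) (\<lambda>\<omega>. \<lambda>i\<in>I. Y i \<omega>)"
proof -
  interpret M: prob_space M by fact
  interpret N: prob_space N by fact
  have X: "\<And>i. i \<in> I \<Longrightarrow> X i \<in> borel_measurable M"
    and Y: "\<And>i. i \<in> I \<Longrightarrow> Y i \<in> borel_measurable N"
    using assms by (auto simp: M.indep_vars_def N.indep_vars_def)
  show ?thesis
  proof (cases "I = {}")
    case True
    show ?thesis unfolding True
      by (rule measure_eqI) (auto simp: sets_PiM_empty emeasure_distr_PiM_empty assms(1,2))
  next
    case False
    have "distr M (PiM I (\<lambda>_. borel)) (\<lambda>\<omega>. \<lambda>i\<in>I. X i \<omega>) = PiM I (\<lambda>i. distr M borel (X i))"
      using M.indep_vars_iff_distr_eq_PiM'[of I X "\<lambda>_. borel"] assms(3) X False by simp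
    also have "\<dots> = PiM I (\<lambda>i. distr N borel (Y i))"
      using assms(5) by (intro PiM_cong) auto
    also have "\<dots> = distr N (PiM I (\<lambda>_. borel)) (\<lambda>\<omega>. \<lambda>i\<in>I. Y i \<omega>)"
      using N.indep_vars_iff_distr_eq_PiM'[of I Y "\<lambda>_. borel"] assms(4) Y False by simp
    finally show ?thesis .
  qed
qed

lemma indep_vars_PiM_coordinates:
  assumes D: "\<And>i. prob_space (D i)" "\<And>i. sets (D i) = sets borel"
  shows "prob_space.indep_vars (PiM I D) (\<lambda>_. borel) (\<lambda>i x. x i) I"
proof -
  interpret product_prob_space D I
    by (intro product_prob_spaceI D)
  have m: "(\<lambda>x. x i) \<in> borel_measurable (PiM I D)" if "i \<in> I" for i
    using measurable_component_singleton[OF that, of D] D(2)[of i] by (simp cong: measurable_cong_sets)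
  have c: "distr (PiM I D) borel (\<lambda>x. x i) = D i" if "i \<in> I" for i
    using PiM_component[OF that] D(2)[of i] by (simp cong: distr_cong)
  show ?thesis
  proof (cases "I = {}")
    case True
    then show ?thesis unfolding P.indep_vars_def2 P.indep_sets_def by simp
  next
    case False
    have "distr (PiM I D) (PiM I (\<lambda>_. borel)) (\<lambda>x. \<lambda>i\<in>I. x i) = distr (PiM I D) (PiM I D) (\<lambda>x. x)"
      using D by (intro distr_cong) (auto intro!: sets_PiM_cong simp: space_PiM)
    also have "\<dots> = PiM I (\<lambda>i. distr (PiM I D) borel (\<lambda>x. x i))"
      by (simp add: distr_id c cong: PiM_cong)
    finally show ?thesis
      using False m by (subst P.indep_vars_iff_distr_eq_PiM') auto
  qed
qed


text \<open>\<open>\<Omega>\<close> carries two independent copies of a Gaussian vector, labelled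
  \<open>True\<close> and \<open>False\<close>. A rotation acts on each pair of coordinates
  separately: it preserves the variance because \<open>u\<close> and \<open>v\<close> lie on the
  unit circle, and distinct indices stay independent because their pairs are disjoint. Positivity of
  \<open>u\<close> and \<open>v\<close> keeps both summands nondegenerate.\<close>

lemma normal_pair_rotation:
  fixes \<sigma> :: "'i \<Rightarrow> real" and u v :: real and I :: "'i set"
  assumes \<sigma>: "\<And>i. 0 < \<sigma> i" and uv: "0 < u" "0 < v" "u\<^sup>2 + v\<^sup>2 = 1"
  defines "\<Omega> \<equiv> PiM (UNIV \<times> I) (\<lambda>(b::bool, i). density lborel (normal_density 0 (\<sigma> i)))"
  shows "prob_space.indep_vars \<Omega> (\<lambda>_. borel) (\<lambda>i x. u * x (True, i) + v * x (False, i)) I"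
    and "i \<in> I \<Longrightarrow> distr \<Omega> borel (\<lambda>x. u * x (True, i) + v * x (False, i))
           = density lborel (normal_density 0 (\<sigma> i))"
    and "i \<in> I \<Longrightarrow> distr \<Omega> borel (\<lambda>x. x (b, i)) = density lborel (normal_density 0 (\<sigma> i))"
    and "prob_space \<Omega>"
    and "prob_space.indep_vars \<Omega> (\<lambda>_. borel) (\<lambda>i x. x (b, i)) I"
    and "prob_space.indep_var \<Omega>
           (PiM I (\<lambda>_. borel)) (\<lambda>x. \<lambda>i\<in>I. x (True, i)) (PiM I (\<lambda>_. borel)) (\<lambda>x. \<lambda>i\<in>I. x (False, i))"
proof -
  define D where "D = (\<lambda>(b::bool, i). density lborel (\<lambda>x. ennreal (normal_density 0 (\<sigma> i) x)))"
  have D: "prob_space (D j)" "sets (D j) = sets borel" for j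
    using prob_space_normal_density[OF \<sigma>] by (auto simp: D_def split: prod.split)
  have \<Omega>: "\<Omega> = PiM (UNIV \<times> I) D" by (simp add: \<Omega>_def D_def)
  interpret product_prob_space D "UNIV \<times> I" by (intro product_prob_spaceI D)
  interpret X: prob_space \<Omega> unfolding \<Omega> by (rule prob_space_PiM) (rule D)
  have ind: "X.indep_vars (\<lambda>_. borel) (\<lambda>j x. x j) (UNIV \<times> I)"
    unfolding \<Omega> by (rule indep_vars_PiM_coordinates[OF D])
  have meas: "(\<lambda>x. x (b, i)) \<in> borel_measurable \<Omega>" if "i \<in> I" for b i
    using ind that by (auto simp: X.indep_vars_def)
  have comp: "distr \<Omega> borel (\<lambda>x. x (b, i)) = density lborel (normal_density 0 (\<sigma> i))"
    if "i \<in> I" for b i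
    using PiM_component[of "(b, i)"] that unfolding \<Omega> by (simp add: D_def cong: distr_cong)
  then show "i \<in> I \<Longrightarrow> distr \<Omega> borel (\<lambda>x. x (b, i)) = density lborel (normal_density 0 (\<sigma> i))" .
  have normal: "distributed \<Omega> lborel (\<lambda>x. x (b, i)) (normal_density 0 (\<sigma> i))" if "i \<in> I" for b i
    using comp[OF that] meas[OF that] by (auto simp: distributed_def cong: distr_cong)
  \<comment> \<open>Coordinates grouped by label: the two copies are independent.\<close>
  have "X.indep_var
      (PiM I (\<lambda>_. borel)) ((\<lambda>y. \<lambda>i\<in>I. y (True, i)) \<circ> (\<lambda>x. restrict (\<lambda>j. x j) ({True} \<times> I)))
      (PiM I (\<lambda>_. borel)) ((\<lambda>y. \<lambda>i\<in>I. y (False, i)) \<circ> (\<lambda>x. restrict (\<lambda>j. x j) ({False} \<times> I)))"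
    by (rule X.indep_var_compose[OF X.indep_var_restrict[OF ind]])
      (auto intro!: measurable_restrict measurable_component_singleton)
  moreover have "(\<lambda>y. \<lambda>i\<in>I. y (b, i) :: real) \<circ> (\<lambda>x. restrict (\<lambda>j. x j) ({b} \<times> I)) = (\<lambda>x. \<lambda>i\<in>I. x (b, i))"
    for b :: bool
    by (auto simp: fun_eq_iff)
  ultimately show "X.indep_var
      (PiM I (\<lambda>_. borel)) (\<lambda>x. \<lambda>i\<in>I. x (True, i)) (PiM I (\<lambda>_. borel)) (\<lambda>x. \<lambda>i\<in>I. x (False, i))"
    by simp
  show "prob_space \<Omega>" by (rule X.prob_space_axioms)
  \<comment> \<open>Coordinates grouped by index instead: the pairs are independent of each other,
    hence so are functions of the single pairs.\<close>
  have pairs: "X.indep_vars (\<lambda>i. PiM (UNIV \<times> {i}) (\<lambda>_. borel)) (\<lambda>i x. restrict (\<lambda>j. x j) (UNIV \<times> {i})) I"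
    by (rule X.indep_vars_restrict[OF ind]) (auto simp: disjoint_family_on_def)
  from pairs have "X.indep_vars (\<lambda>_. borel)
      (\<lambda>i x. (\<lambda>y. y (b, i)) (restrict (\<lambda>j. x j) (UNIV \<times> {i}))) I"
    by (rule X.indep_vars_compose2) simp
  then show "X.indep_vars (\<lambda>_. borel) (\<lambda>i x. x (b, i)) I" by simp
  from pairs have "X.indep_vars (\<lambda>_. borel)
      (\<lambda>i x. (\<lambda>y. u * y (True, i) + v * y (False, i)) (restrict (\<lambda>j. x j) (UNIV \<times> {i}))) I"
    by (rule X.indep_vars_compose2) simp
  then show "X.indep_vars (\<lambda>_. borel) (\<lambda>i x. u * x (True, i) + v * x (False, i)) I" by simp
  assume i: "i \<in> I"
  have "X.indep_var borel ((\<lambda>y. u * y (True, i)) \<circ> (\<lambda>x. restrict (\<lambda>j. x j) {(True, i)}))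
                    borel ((\<lambda>y. v * y (False, i)) \<circ> (\<lambda>x. restrict (\<lambda>j. x j) {(False, i)}))"
    by (rule X.indep_var_compose[OF X.indep_var_restrict[OF ind]]) (use i in auto)
  then have "X.indep_var borel (\<lambda>x. u * x (True, i)) borel (\<lambda>x. v * x (False, i))"
    by (simp add: comp_def)
  moreover have "distributed \<Omega> lborel (\<lambda>x. u * x (True, i)) (normal_density 0 (u * \<sigma> i))"
    using X.normal_density_affine[OF normal[OF i], of u 0 True] uv \<sigma>[of i] by simp
  moreover have "distributed \<Omega> lborel (\<lambda>x. v * x (False, i)) (normal_density 0 (v * \<sigma> i))"
    using X.normal_density_affine[OF normal[OF i], of v 0 False] uv \<sigma>[of i] by simp
  ultimately have *: "distributed \<Omega> lborel (\<lambda>x. u * x (True, i) + v * x (False, i))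
      (normal_density (0 + 0) (sqrt ((u * \<sigma> i)\<^sup>2 + (v * \<sigma> i)\<^sup>2)))"
    using uv \<sigma>[of i] by (intro X.add_indep_normal) auto
  have "(u * \<sigma> i)\<^sup>2 + (v * \<sigma> i)\<^sup>2 = (u\<^sup>2 + v\<^sup>2) * (\<sigma> i)\<^sup>2" by (simp add: power_mult_distrib algebra_simps)
  then have "sqrt ((u * \<sigma> i)\<^sup>2 + (v * \<sigma> i)\<^sup>2) = \<sigma> i" using \<sigma>[of i] uv by simp
  with * show "distr \<Omega> borel (\<lambda>x. u * x (True, i) + v * x (False, i))
      = density lborel (normal_density 0 (\<sigma> i))"
    by (simp add: distributed_def cong: distr_cong)
qed


section \<open>The small-ball inequality for Gaussian polynomials\<close>

text \<open>The polynomial in \<open>t\<close> is \<open>P - c\<close> along the rotation,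
  multiplied by \<open>(1 + t^2)^q\<close>. The rational parametrization of the circle makes every
  rotated coordinate a quadratic polynomial divided by \<open>1 + t^2\<close>, so a product of
  \<open>q\<close> of them has degree at most \<open>2 * q\<close> once denominators are
  cleared.\<close>

lemma degree_rotation_poly:
  fixes x y :: "nat \<Rightarrow> real"
  assumes S: "finite S"
  shows "degree ((\<Sum>k\<in>S. smult (a k) (\<Prod>j<q. [:x (k j), 2 * y (k j), - x (k j):]))
            - smult c ([:1, 0, 1:] ^ q)) \<le> 2 * q"
proof -
  have "degree (\<Prod>j<q. [:x (k j), 2 * y (k j), - x (k j):]) \<le> 2 * q" for k :: "nat \<Rightarrow> nat"
  proof -
    have "degree (\<Prod>j<q. [:x (k j), 2 * y (k j), - x (k j):])
        \<le> (\<Sum>j<q. degree [:x (k j), 2 * y (k j), - x (k j):])"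
      by (rule order.trans[OF degree_prod_sum_le]) (auto simp: comp_def)
    also have "\<dots> \<le> (\<Sum>j<q. 2)" by (intro sum_mono) (auto simp: degree_pCons_eq_if)
    finally show ?thesis by simp
  qed
  then have "degree (smult (a k) (\<Prod>j<q. [:x (k j), 2 * y (k j), - x (k j):])) \<le> 2 * q" for k
    using degree_smult_le order.trans by blast
  moreover have "degree ([:1, 0, 1::real:] ^ q) \<le> 2 * q"
    using degree_power_le[of "[:1, 0, 1::real:]" q] by simp
  ultimately show ?thesis using S
    by (intro degree_diff_le) (auto intro!: degree_sum_le intro: order.trans[OF degree_smult_le])
qed

lemma poly_rotation_poly:
  fixes x y :: "nat \<Rightarrow> real"
  shows "poly ((\<Sum>k\<in>S. smult (a k) (\<Prod>j<q. [:x (k j), 2 * y (k j), - x (k j):]))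
            - smult c ([:1, 0, 1:] ^ q)) t
    = (1 + t\<^sup>2) ^ q * ((\<Sum>k\<in>S. a k * (\<Prod>j<q. (1 - t\<^sup>2) / (1 + t\<^sup>2) * x (k j) + 2 * t / (1 + t\<^sup>2) * y (k j))) - c)"
proof -
  have pos: "1 + t\<^sup>2 > 0" by (simp add: add_pos_nonneg)
  have "poly [:x (k j), 2 * y (k j), - x (k j):] t
      = (1 + t\<^sup>2) * ((1 - t\<^sup>2) / (1 + t\<^sup>2) * x (k j) + 2 * t / (1 + t\<^sup>2) * y (k j))" for k :: "nat \<Rightarrow> nat" and j
  proof -
    have "(1 + t\<^sup>2) * ((1 - t\<^sup>2) / (1 + t\<^sup>2) * x (k j) + 2 * t / (1 + t\<^sup>2) * y (k j))
        = (1 - t\<^sup>2) * x (k j) + 2 * t * y (k j)"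
      using pos by (simp add: distrib_left)
    then show ?thesis by (simp add: power2_eq_square algebra_simps)
  qed
  then have "(\<Prod>j<q. poly [:x (k j), 2 * y (k j), - x (k j):] t)
      = (1 + t\<^sup>2) ^ q * (\<Prod>j<q. (1 - t\<^sup>2) / (1 + t\<^sup>2) * x (k j) + 2 * t / (1 + t\<^sup>2) * y (k j))" for k :: "nat \<Rightarrow> nat"
    by (simp only: prod.distrib) simp
  then show ?thesis
    by (simp del: poly_pCons add: poly_sum poly_prod sum_distrib_left algebra_simps)
      (simp add: power2_eq_square algebra_simps)
qed


text \<open>The expected number of nodes at which the rotated polynomial is \<open>e\<close>-close
  to \<open>c\<close> is computed in two ways. Invariance of the law gives the left side; a
  pointwise count gives the right side, where the square comes from the independence of the two
  copies. In \<open>C\<close> the factor \<open>2 ^ q\<close> bounds the cleared denominators and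
  the rest comes from \<open>poly_bounded_by_nodes\<close> with spacing \<open>1 / (N + 1)\<close>;
  the number \<open>n\<close> of variables does not enter.\<close>

lemma gaussian_polynomial_small_ball:
  fixes \<Delta> :: "nat \<Rightarrow> 'a \<Rightarrow> real" and a :: "(nat \<Rightarrow> nat) \<Rightarrow> real" and N :: nat
  assumes M: "prob_space M" and ind: "prob_space.indep_vars M (\<lambda>_. borel) \<Delta> {..<n}"
    and \<sigma>: "\<And>i. 0 < \<sigma> i"
    and normal: "\<And>i. i < n \<Longrightarrow> distr M borel (\<Delta> i) = density lborel (normal_density 0 (\<sigma> i))"
    and S: "finite S" "\<And>k j. k \<in> S \<Longrightarrow> j < q \<Longrightarrow> k j < n"
  defines "G \<equiv> (\<lambda>\<omega>. \<Sum>k\<in>S. a k * (\<Prod>j<q. \<Delta> (k j) \<omega>))"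
    and "C \<equiv> 2 ^ q * (1 + 2 * (real N + 1)) ^ (2 * q)"
  shows "N * measure M {\<omega> \<in> space M. \<bar>G \<omega> - c\<bar> \<le> e}
    \<le> 2 * real q + N * (measure M {\<omega> \<in> space M. \<bar>G \<omega> - c\<bar> \<le> C * e})\<^sup>2"
proof -
  define I where "I = {..<n}"
  define B where "B = PiM I (\<lambda>_. borel :: real measure)"
  define g where "g = (\<lambda>x :: nat \<Rightarrow> real. \<Sum>k\<in>S. a k * (\<Prod>j<q. x (k j)))"
  define m where "m = (\<lambda>r. measure M {\<omega> \<in> space M. \<bar>G \<omega> - c\<bar> \<le> r})"
  define \<Omega> where "\<Omega> = PiM (UNIV \<times> I) (\<lambda>(b::bool, i). density lborel (\<lambda>x. ennreal (normal_density 0 (\<sigma> i) x)))"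
  define U V where "U = (\<lambda>t::real. (1 - t\<^sup>2) / (1 + t\<^sup>2))" and "V = (\<lambda>t::real. 2 * t / (1 + t\<^sup>2))"
  \<comment> \<open>The nodes are the multiples of \<open>1 / (N + 1)\<close> strictly between 0 and
    1, so that both rotation coefficients are positive at every node.\<close>
  define \<delta> where "\<delta> = 1 / (real N + 1)"
  define T where "T = (\<lambda>s. real s * \<delta>) ` {1..N}"
  have \<delta>: "\<delta> > 0" and \<delta>N: "real N * \<delta> < 1" by (auto simp: \<delta>_def)
  have T01: "0 < t" "t < 1" if "t \<in> T" for t
  proof -
    from that obtain s where s: "t = real s * \<delta>" "1 \<le> s" "s \<le> N" unfolding T_def by (elim imageE) (metis atLeastAtMost_iff)
    then show "0 < t" using \<delta> by simp
    have "real s * \<delta> \<le> real N * \<delta>" using s \<delta> by (intro mult_right_mono) auto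
    then show "t < 1" using \<delta>N s by simp
  qed
  have cardT: "card T = N" "finite T"
    using \<delta> by (auto simp: T_def card_image inj_on_def)
  have sepT: "\<delta> \<le> \<bar>s - t\<bar>" if "s \<in> T" "t \<in> T" "s \<noteq> t" for s t
  proof -
    from that obtain i j where ij: "s = real i * \<delta>" "t = real j * \<delta>" by (auto simp: T_def)
    with that have "i \<noteq> j" by auto
    then have "1 * \<delta> \<le> \<bar>real i - real j\<bar> * \<delta>" using \<delta> by (intro mult_right_mono) linarith+
    then show ?thesis using \<delta> by (simp add: ij left_diff_distrib[symmetric] abs_mult)
  qed
  have UV: "0 < U t" "0 < V t" "(U t)\<^sup>2 + (V t)\<^sup>2 = 1" if "t \<in> T" for t
  proof -
    have p: "1 + t\<^sup>2 > 0" by (simp add: add_pos_nonneg)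
    show "0 < U t" "0 < V t" using T01[OF that] p by (auto simp: U_def V_def power_less_one_iff)
    have "(1 - t\<^sup>2)\<^sup>2 + (2 * t)\<^sup>2 = (1 + t\<^sup>2)\<^sup>2" by (simp add: power2_eq_square algebra_simps)
    then show "(U t)\<^sup>2 + (V t)\<^sup>2 = 1"
      using p by (simp add: U_def V_def power_divide add_divide_distrib[symmetric])
  qed
  note rot = normal_pair_rotation[where \<sigma>=\<sigma> and I=I, OF \<sigma>, folded \<Omega>_def]
  \<comment> \<open>some rotation, to use the parts of \<open>normal_pair_rotation\<close> that do not depend on the angle\<close>
  have half: "0 < (3/5::real)" "0 < (4/5::real)" "(3/5::real)\<^sup>2 + (4/5)\<^sup>2 = 1"
    by (auto simp: power2_eq_square)
  interpret M: prob_space M by fact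
  interpret X: prob_space \<Omega> by (rule rot(4)[OF half])
  have g_meas[measurable]: "g \<in> borel_measurable B"
    unfolding g_def B_def using S by (intro borel_measurable_sum borel_measurable_times borel_measurable_prod)
      (auto intro!: measurable_component_singleton simp: I_def)
  have g_restrict: "g (\<lambda>i\<in>I. x i) = g x" for x
    unfolding g_def using S by (intro sum.cong prod.cong arg_cong2[where f="(*)"]) (auto simp: I_def)
  have G: "G \<omega> = g (\<lambda>i. \<Delta> i \<omega>)" for \<omega> by (simp add: G_def g_def)
  \<comment> \<open>Transfers probabilities from \<open>\<Omega>\<close> to \<open>M\<close>: any
    independent family on \<open>\<Omega>\<close> with the right marginals has the joint law of
    \<open>\<Delta>\<close>. It is used for the rotated vectors and for both copies.\<close>
  have law: "measure \<Omega> {x \<in> space \<Omega>. \<bar>g (\<lambda>i. Y i x) - c\<bar> \<le> r} = m r"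
    if Y: "X.indep_vars (\<lambda>_. borel) Y I"
      "\<And>i. i \<in> I \<Longrightarrow> distr \<Omega> borel (Y i) = density lborel (normal_density 0 (\<sigma> i))" for Y r
  proof -
    have [measurable]: "(\<lambda>x. \<lambda>i\<in>I. Y i x) \<in> \<Omega> \<rightarrow>\<^sub>M B" "(\<lambda>\<omega>. \<lambda>i\<in>I. \<Delta> i \<omega>) \<in> M \<rightarrow>\<^sub>M B"
      using Y(1) ind unfolding B_def I_def
      by (auto simp: X.indep_vars_def M.indep_vars_def intro!: measurable_restrict)
    have "distr \<Omega> B (\<lambda>x. \<lambda>i\<in>I. Y i x) = distr M B (\<lambda>\<omega>. \<lambda>i\<in>I. \<Delta> i \<omega>)"
      unfolding B_def using Y ind normal
      by (intro distr_PiM_eq_of_indep) (auto simp: M X.prob_space_axioms I_def)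
    then have "measure (distr \<Omega> B (\<lambda>x. \<lambda>i\<in>I. Y i x)) {x \<in> space B. \<bar>g x - c\<bar> \<le> r}
        = measure (distr M B (\<lambda>\<omega>. \<lambda>i\<in>I. \<Delta> i \<omega>)) {x \<in> space B. \<bar>g x - c\<bar> \<le> r}" by simp
    moreover have "(\<lambda>x. \<lambda>i\<in>I. Y i x) -` {x \<in> space B. \<bar>g x - c\<bar> \<le> r} \<inter> space \<Omega>
        = {x \<in> space \<Omega>. \<bar>g (\<lambda>i. Y i x) - c\<bar> \<le> r}"
      by (auto simp: g_restrict B_def space_PiM)
    moreover have "(\<lambda>x. \<lambda>i\<in>I. \<Delta> i x) -` {x \<in> space B. \<bar>g x - c\<bar> \<le> r} \<inter> space M
        = {x \<in> space M. \<bar>G x - c\<bar> \<le> r}"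
      by (auto simp: g_restrict G B_def space_PiM)
    ultimately show ?thesis by (simp add: measure_distr m_def)
  qed
  \<comment> \<open>\<open>E t\<close> is closeness at the node \<open>t\<close>; \<open>F\<close>
    is closeness, at the larger radius \<open>C * e\<close>, of both copies, that is at
    \<open>t = 0\<close> and \<open>t = 1\<close>.\<close>
  define E where "E = (\<lambda>t. {x \<in> space \<Omega>. \<bar>g (\<lambda>i. U t * x (True, i) + V t * x (False, i)) - c\<bar> \<le> e})"
  define F where "F = {x \<in> space \<Omega>. \<bar>g (\<lambda>i. x (True, i)) - c\<bar> \<le> C * e \<and> \<bar>g (\<lambda>i. x (False, i)) - c\<bar> \<le> C * e}"
  have co: "(\<lambda>x. \<lambda>i\<in>I. x (b, i)) \<in> \<Omega> \<rightarrow>\<^sub>M B" for b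
    using rot(5)[OF half, of b] unfolding B_def by (auto simp: X.indep_vars_def intro!: measurable_restrict)
  have gco[measurable]: "(\<lambda>x. g (\<lambda>i. x (b, i))) \<in> borel_measurable \<Omega>" for b
    using measurable_compose[OF co g_meas] by (simp add: g_restrict)
  have E_meas: "E t \<in> sets \<Omega>" for t
  proof -
    have "(\<lambda>x. \<lambda>i\<in>I. U t * x (True, i) + V t * x (False, i)) \<in> \<Omega> \<rightarrow>\<^sub>M B"
      using rot(5)[OF half] unfolding B_def
      by (auto simp: X.indep_vars_def intro!: measurable_restrict borel_measurable_add borel_measurable_times)
    from measurable_compose[OF this g_meas] show ?thesis unfolding E_def by (simp add: g_restrict)
  qed
  have F_meas[measurable]: "F \<in> sets \<Omega>" unfolding F_def by measurable
  have E_prob: "X.prob (E t) = m e" if "t \<in> T" for t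
    unfolding E_def using rot(1,2)[OF UV[OF that]] by (intro law)
  have F_prob: "X.prob F = (m (C * e))\<^sup>2"
  proof -
    have "X.indep_var borel (g \<circ> (\<lambda>x. \<lambda>i\<in>I. x (True, i))) borel (g \<circ> (\<lambda>x. \<lambda>i\<in>I. x (False, i)))"
      using rot(6)[OF half] g_meas unfolding B_def by (intro X.indep_var_compose)
    then have "X.indep_var borel (\<lambda>x. g (\<lambda>i. x (True, i))) borel (\<lambda>x. g (\<lambda>i. x (False, i)))"
      by (simp add: comp_def g_restrict)
    from X.prob_indep_random_variable[OF this, of "{y. \<bar>y - c\<bar> \<le> C * e}" "{y. \<bar>y - c\<bar> \<le> C * e}"]
    have "X.prob F = X.prob {x \<in> space \<Omega>. \<bar>g (\<lambda>i. x (True, i)) - c\<bar> \<le> C * e}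
        * X.prob {x \<in> space \<Omega>. \<bar>g (\<lambda>i. x (False, i)) - c\<bar> \<le> C * e}"
      by (simp add: F_def)
    then show ?thesis
      using rot(3,5)[OF half] by (simp add: law power2_eq_square)
  qed
  \<comment> \<open>Either at most \<open>2 * q\<close> nodes are good, or there are enough of them
    to control a polynomial of degree at most \<open>2 * q\<close> on the whole of
    \<open>[0,1]\<close>; then \<open>x\<close> lies in \<open>F\<close>, and the trivial bound
    \<open>N\<close> on the number of nodes suffices.\<close>
  have count: "(\<Sum>t\<in>T. indicator (E t) x) \<le> 2 * real q + N * indicat_real F x" if x: "x \<in> space \<Omega>" for x
  proof -
    define R where "R = {t \<in> T. x \<in> E t}"
    have R: "finite R" "R \<subseteq> T" using cardT by (auto simp: R_def)
    have sumR: "(\<Sum>t\<in>T. indicator (E t) x) = real (card R)"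
      using cardT by (simp add: R_def indicator_def sum.If_cases Int_def)
    show ?thesis
    proof (cases "card R \<le> 2 * q")
      case True
      then show ?thesis unfolding sumR by (auto simp: indicator_def)
    next
      case False
      define Q where "Q = (\<Sum>k\<in>S. smult (a k) (\<Prod>j<q. [:x (True, k j), 2 * x (False, k j), - x (True, k j):]))
        - smult c ([:1, 0, 1:] ^ q)"
      have Q: "poly Q t = (1 + t\<^sup>2) ^ q * (g (\<lambda>i. U t * x (True, i) + V t * x (False, i)) - c)" for t
        unfolding Q_def g_def U_def V_def
        by (rule poly_rotation_poly[where x="\<lambda>i. x (True, i)" and y="\<lambda>i. x (False, i)"])
      have bound: "\<bar>poly Q y\<bar> \<le> (1 + 2 / \<delta>) ^ (2 * q) * (2 ^ q * e)" if "y \<in> {0..1}" for y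
      proof (rule poly_bounded_by_nodes[OF _ R(1) _ \<delta> _ _ _ that])
        show "degree Q \<le> 2 * q" unfolding Q_def
          by (rule degree_rotation_poly[OF S(1), where x="\<lambda>i. x (True, i)" and y="\<lambda>i. x (False, i)"])
        show "2 * q < card R" using False by simp
        show "R \<subseteq> {0..1}" using R(2) by (auto dest!: subsetD intro: less_imp_le[OF T01(1)] less_imp_le[OF T01(2)])
        show "\<delta> \<le> \<bar>s - t\<bar>" if "s \<in> R" "t \<in> R" "s \<noteq> t" for s t
          using sepT that R by auto
        show "\<bar>poly Q t\<bar> \<le> 2 ^ q * e" if "t \<in> R" for t
        proof -
          have "t\<^sup>2 \<le> 1" using T01[of t] that R by (auto simp: power_le_one)
          then have "(1 + t\<^sup>2) ^ q \<le> 2 ^ q" by (intro power_mono) auto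
          moreover have "\<bar>g (\<lambda>i. U t * x (True, i) + V t * x (False, i)) - c\<bar> \<le> e"
            using that by (simp add: R_def E_def)
          ultimately show ?thesis unfolding Q abs_mult by (intro mult_mono) auto
        qed
      qed
      have "(1 + 2 / \<delta>) ^ (2 * q) * (2 ^ q * e) = C * e"
        by (simp add: C_def \<delta>_def mult_ac add_ac)
      note bound = bound[unfolded this]
      have "\<bar>g (\<lambda>i. x (True, i)) - c\<bar> \<le> C * e"
        using bound[of 0] by (simp add: Q U_def V_def)
      \<comment> \<open>At \<open>t = 1\<close> the cleared denominator is \<open>2 ^ q\<close>, and
        dropping this factor keeps the upper bound.\<close>
      moreover have "1 * \<bar>g (\<lambda>i. x (False, i)) - c\<bar> \<le> 2 ^ q * \<bar>g (\<lambda>i. x (False, i)) - c\<bar>"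
        by (intro mult_right_mono) auto
      then have "\<bar>g (\<lambda>i. x (False, i)) - c\<bar> \<le> C * e"
        using bound[of 1] by (simp add: Q U_def V_def abs_mult)
      ultimately have "x \<in> F" using x by (simp add: F_def)
      moreover have "card R \<le> N" using R cardT card_mono by metis
      ultimately show ?thesis unfolding sumR by simp
    qed
  qed
  have "N * m e = (\<Sum>t\<in>T. X.prob (E t))" using E_prob cardT by simp
  also have "\<dots> = X.expectation (\<lambda>x. \<Sum>t\<in>T. indicator (E t) x)"
    using E_meas by (subst Bochner_Integration.integral_sum) (auto simp: X.emeasure_eq_measure)
  also have "\<dots> \<le> X.expectation (\<lambda>x. 2 * real q + N * indicat_real F x)"
    using E_meas F_meas count
    by (intro integral_mono Bochner_Integration.integrable_sum) (auto simp: X.emeasure_eq_measure)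
  also have "\<dots> = 2 * real q + N * X.prob F"
    using F_meas X.prob_space by (simp add: X.emeasure_eq_measure)
  finally show ?thesis unfolding F_prob m_def .
qed


section \<open>The zero-one law for atoms in a Wiener chaos\<close>

text \<open>Provides the Gaussian input for elementary integrals. The value 1 of
  \<open>\<sigma>\<close> from \<open>n\<close> on is a filler that keeps it positive at every
  index, as \<open>gaussian_polynomial_small_ball\<close> requires.\<close>

lemma wiener_increments:
  assumes W: "wiener_process M T W" and el: "elementary_on T (n, t, a)"
  defines "\<sigma> \<equiv> (\<lambda>i. if i < n then sqrt (t (Suc i) - t i) else 1)"
  shows "prob_space.indep_vars M (\<lambda>_. borel) (\<lambda>i \<omega>. W (t (Suc i)) \<omega> - W (t i) \<omega>) {..<n}"
    and "0 < \<sigma> i"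
    and "i < n \<Longrightarrow> distr M borel (\<lambda>\<omega>. W (t (Suc i)) \<omega> - W (t i) \<omega>) = density lborel (normal_density 0 (\<sigma> i))"
proof -
  have t: "\<forall>i\<le>n. t i \<in> T" "\<forall>i<n. t i < t (Suc i)" using el by auto
  then show "prob_space.indep_vars M (\<lambda>_. borel) (\<lambda>i \<omega>. W (t (Suc i)) \<omega> - W (t i) \<omega>) {..<n}"
    using W unfolding wiener_process_def by blast
  show "0 < \<sigma> i" using t by (simp add: \<sigma>_def)
  assume "i < n"
  with t W have "distributed M lborel (\<lambda>\<omega>. W (t (Suc i)) \<omega> - W (t i) \<omega>) (normal_density 0 (sqrt (t (Suc i) - t i)))"
    unfolding wiener_process_def by (meson Suc_leI less_imp_le)
  with \<open>i < n\<close> show "distr M borel (\<lambda>\<omega>. W (t (Suc i)) \<omega> - W (t i) \<omega>) = density lborel (normal_density 0 (\<sigma> i))"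
    by (simp add: distributed_def \<sigma>_def cong: distr_cong)
qed

lemma finite_offdiagonal_indices: "finite (offdiagonal_indices q n)"
  unfolding offdiagonal_indices_def by (rule finite_subset[of _ "{..<q} \<rightarrow>\<^sub>E {..<n}"]) (auto intro: finite_PiE)

text \<open>An elementary integral is a polynomial in the increments over its cells.
  \<open>C\<close> is the same for all elementary data \<open>d\<close>, so the bound can be used
  along a whole approximating sequence.\<close>

lemma elementary_integral_small_ball:
  fixes N q :: nat
  assumes W: "wiener_process M T W" and el: "elementary_on T d"
  defines "C \<equiv> 2 ^ q * (1 + 2 * (real N + 1)) ^ (2 * q)"
  shows "N * measure M {\<omega> \<in> space M. \<bar>elementary_integral W q d \<omega> - c\<bar> \<le> e}
    \<le> 2 * real q + N * (measure M {\<omega> \<in> space M. \<bar>elementary_integral W q d \<omega> - c\<bar> \<le> C * e})\<^sup>2"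
proof -
  obtain n t a where d: "d = (n, t, a)" by (cases d)
  have "prob_space M" using W by (simp add: wiener_process_def)
  note inc = wiener_increments[OF W el[unfolded d]]
  show ?thesis unfolding d elementary_integral.simps C_def
    by (rule gaussian_polynomial_small_ball[where a=a,
        OF \<open>prob_space M\<close> inc finite_offdiagonal_indices])
      (auto simp: offdiagonal_indices_def)
qed

lemma elementary_integral_measurable:
  assumes "wiener_process M T W" "elementary_on T d"
  shows "elementary_integral W q d \<in> borel_measurable M"
proof -
  obtain n t a where d: "d = (n, t, a)" by (cases d)
  have W: "W (t i) \<in> borel_measurable M" if "i \<le> n" for i
    using assms that by (auto simp: d wiener_process_def)
  show ?thesis unfolding d elementary_integral.simps
    by (intro borel_measurable_sum borel_measurable_times borel_measurable_prod borel_measurable_diff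
        borel_measurable_const W) (auto simp: offdiagonal_indices_def PiE_iff less_imp_le Suc_leI)
qed

text \<open>Chebyshev's inequality; with the cube in the hypothesis, a single
  \<open>\<epsilon>\<close> bounds both the deviation and its probability, since
  \<open>\<epsilon>^3 / \<epsilon>^2 = \<epsilon>\<close>.\<close>

lemma L2_Markov:
  assumes "prob_space M" and [measurable]: "F \<in> borel_measurable M" and "\<epsilon> > 0"
    and "(\<integral>\<^sup>+\<omega>. ennreal ((F \<omega>)\<^sup>2) \<partial>M) \<le> ennreal (\<epsilon> ^ 3)"
  shows "measure M {\<omega> \<in> space M. \<epsilon> \<le> \<bar>F \<omega>\<bar>} \<le> \<epsilon>"
proof -
  interpret prob_space M by fact
  have "{\<omega> \<in> space M. \<epsilon> \<le> \<bar>F \<omega>\<bar>} \<subseteq> {\<omega> \<in> space M. 1 \<le> ennreal (1 / \<epsilon>\<^sup>2) * ennreal ((F \<omega>)\<^sup>2)}"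
  proof safe
    fix \<omega> assume "\<epsilon> \<le> \<bar>F \<omega>\<bar>"
    then have "\<epsilon>\<^sup>2 \<le> (F \<omega>)\<^sup>2" using \<open>\<epsilon> > 0\<close> by (simp add: abs_le_square_iff[symmetric])
    then show "1 \<le> ennreal (1 / \<epsilon>\<^sup>2) * ennreal ((F \<omega>)\<^sup>2)"
      using \<open>\<epsilon> > 0\<close> by (simp add: ennreal_mult'[symmetric] field_simps)
  qed
  then have "emeasure M {\<omega> \<in> space M. \<epsilon> \<le> \<bar>F \<omega>\<bar>}
      \<le> emeasure M {\<omega> \<in> space M. 1 \<le> ennreal (1 / \<epsilon>\<^sup>2) * ennreal ((F \<omega>)\<^sup>2)}"
    by (intro emeasure_mono) auto
  also have "\<dots> \<le> ennreal (1 / \<epsilon>\<^sup>2) * (\<integral>\<^sup>+\<omega>. ennreal ((F \<omega>)\<^sup>2) * indicator (space M) \<omega> \<partial>M)"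
    by (rule nn_integral_Markov_inequality) auto
  also have "\<dots> = ennreal (1 / \<epsilon>\<^sup>2) * (\<integral>\<^sup>+\<omega>. ennreal ((F \<omega>)\<^sup>2) \<partial>M)"
    by (intro arg_cong2[where f="(*)"] nn_integral_cong) auto
  also have "\<dots> \<le> ennreal (1 / \<epsilon>\<^sup>2) * ennreal (\<epsilon> ^ 3)"
    using assms by (intro mult_left_mono) auto
  also have "\<dots> = ennreal \<epsilon>"
    using \<open>\<epsilon> > 0\<close> by (simp add: ennreal_mult'[symmetric] power2_eq_square power3_eq_cube)
  finally show ?thesis using \<open>\<epsilon> > 0\<close> by (simp add: emeasure_eq_measure)
qed

text \<open>For a probability \<open>p\<close> the conclusion means that \<open>p\<close> is 0 or 1.
  The limits are taken in a fixed order: for given \<open>N\<close>, hence given \<open>C\<close>,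
  first \<open>\<epsilon>\<close> tends to 0, and only then does \<open>N\<close> grow.\<close>

lemma wiener_chaos_atom:
  fixes c :: real
  assumes W: "wiener_process M T W" and F: "F \<in> wiener_chaos M T W q"
  defines "p \<equiv> measure M {\<omega> \<in> space M. F \<omega> = c}"
  shows "p \<le> p\<^sup>2"
proof -
  interpret prob_space M using W by (simp add: wiener_process_def)
  from F obtain f d where [measurable]: "F \<in> borel_measurable M"
    and d: "\<And>m. elementary_on T (d m)"
    and lim: "(\<lambda>m. \<integral>\<^sup>+\<omega>. ennreal ((elementary_integral W q (d m) \<omega> - F \<omega>)\<^sup>2) \<partial>M) \<longlonglongrightarrow> 0"
    unfolding wiener_chaos_def is_multiple_integral_def by blast
  have N_bound: "N * p \<le> 2 * real q + N * p\<^sup>2" if "0 < N" for N :: nat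
  proof -
    define C where "C = 2 ^ q * (1 + 2 * (real N + 1)) ^ (2 * q)"
    have "C \<ge> 0" by (simp add: C_def)
    \<comment> \<open>The radius adds \<open>C * \<epsilon>\<close> from the small-ball bound to the
      error \<open>\<epsilon>\<close> made in replacing \<open>F\<close> by an elementary integral
      \<open>P\<close> outside the exceptional event \<open>B\<close>.\<close>
    define A where "A = (\<lambda>\<epsilon>. {\<omega> \<in> space M. \<bar>F \<omega> - c\<bar> \<le> (C + 1) * \<epsilon>})"
    have step: "N * (p - \<epsilon>) \<le> 2 * real q + N * (prob (A \<epsilon>) + \<epsilon>)\<^sup>2" if "\<epsilon> > 0" for \<epsilon>
    proof -
      have "\<forall>\<^sub>F m in sequentially. (\<integral>\<^sup>+\<omega>. ennreal ((elementary_integral W q (d m) \<omega> - F \<omega>)\<^sup>2) \<partial>M) < ennreal (\<epsilon> ^ 3)"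
        using order_tendstoD(2)[OF lim, of "ennreal (\<epsilon> ^ 3)"] that by simp
      then obtain m where m: "(\<integral>\<^sup>+\<omega>. ennreal ((elementary_integral W q (d m) \<omega> - F \<omega>)\<^sup>2) \<partial>M) < ennreal (\<epsilon> ^ 3)"
        by (auto simp: eventually_sequentially)
      define P where "P = elementary_integral W q (d m)"
      have [measurable]: "P \<in> borel_measurable M"
        unfolding P_def by (rule elementary_integral_measurable[OF W d])
      define B where "B = {\<omega> \<in> space M. \<epsilon> \<le> \<bar>P \<omega> - F \<omega>\<bar>}"
      have B: "prob B \<le> \<epsilon>" unfolding B_def
        using m that by (intro L2_Markov) (auto simp: P_def[symmetric] prob_space_axioms)
      have meas[measurable]: "B \<in> events" "A \<epsilon> \<in> events" by (auto simp: B_def A_def)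
      have "p \<le> prob ({\<omega> \<in> space M. \<bar>P \<omega> - c\<bar> \<le> \<epsilon>} \<union> B)"
        unfolding p_def by (rule finite_measure_mono) (auto simp: B_def)
      also have "\<dots> \<le> prob {\<omega> \<in> space M. \<bar>P \<omega> - c\<bar> \<le> \<epsilon>} + prob B"
        by (rule measure_Un_le) auto
      finally have "p - \<epsilon> \<le> prob {\<omega> \<in> space M. \<bar>P \<omega> - c\<bar> \<le> \<epsilon>}" using B by simp
      then have "N * (p - \<epsilon>) \<le> N * prob {\<omega> \<in> space M. \<bar>P \<omega> - c\<bar> \<le> \<epsilon>}"
        by (rule mult_left_mono) simp
      also have "\<dots> \<le> 2 * real q + N * (prob {\<omega> \<in> space M. \<bar>P \<omega> - c\<bar> \<le> C * \<epsilon>})\<^sup>2"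
        unfolding P_def C_def by (rule elementary_integral_small_ball[OF W d])
      finally have 1: "N * (p - \<epsilon>) \<le> 2 * real q + N * (prob {\<omega> \<in> space M. \<bar>P \<omega> - c\<bar> \<le> C * \<epsilon>})\<^sup>2" .
      have "prob {\<omega> \<in> space M. \<bar>P \<omega> - c\<bar> \<le> C * \<epsilon>} \<le> prob (A \<epsilon> \<union> B)"
        by (rule finite_measure_mono) (auto simp: A_def B_def algebra_simps)
      also have "\<dots> \<le> prob (A \<epsilon>) + prob B" by (rule measure_Un_le) auto
      finally have "prob {\<omega> \<in> space M. \<bar>P \<omega> - c\<bar> \<le> C * \<epsilon>} \<le> prob (A \<epsilon>) + \<epsilon>" using B by simp
      then have "N * (prob {\<omega> \<in> space M. \<bar>P \<omega> - c\<bar> \<le> C * \<epsilon>})\<^sup>2 \<le> N * (prob (A \<epsilon>) + \<epsilon>)\<^sup>2"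
        by (intro mult_left_mono power_mono) auto
      with 1 show ?thesis by simp
    qed
    \<comment> \<open>Along this sequence the events \<open>A (\<epsilon> k)\<close> decrease to the
      event \<open>F = c\<close>, so their probabilities tend to \<open>p\<close> by continuity from
      above.\<close>
    define \<epsilon> where "\<epsilon> = (\<lambda>k::nat. inverse (real (Suc k)))"
    have \<epsilon>: "\<epsilon> \<longlonglongrightarrow> 0" unfolding \<epsilon>_def by (rule LIMSEQ_inverse_real_of_nat)
    have "(\<lambda>k. prob (A (\<epsilon> k))) \<longlonglongrightarrow> prob (\<Inter>k. A (\<epsilon> k))"
    proof (rule finite_Lim_measure_decseq)
      show "range (\<lambda>k. A (\<epsilon> k)) \<subseteq> events" by (auto simp: A_def)
      show "decseq (\<lambda>k. A (\<epsilon> k))"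
      proof (rule decseq_SucI)
        fix k
        have "(C + 1) * \<epsilon> (Suc k) \<le> (C + 1) * \<epsilon> k"
          using \<open>C \<ge> 0\<close> by (intro mult_left_mono) (auto simp: \<epsilon>_def field_simps)
        then show "A (\<epsilon> (Suc k)) \<subseteq> A (\<epsilon> k)" by (auto simp: A_def)
      qed
    qed
    also have "(\<Inter>k. A (\<epsilon> k)) = {\<omega> \<in> space M. F \<omega> = c}"
    proof safe
      fix \<omega> assume \<omega>: "\<omega> \<in> (\<Inter>k. A (\<epsilon> k))"
      then show "\<omega> \<in> space M" by (auto simp: A_def)
      have "(\<lambda>k. (C + 1) * \<epsilon> k) \<longlonglongrightarrow> (C + 1) * 0" by (intro tendsto_intros \<epsilon>)
      then have "\<bar>F \<omega> - c\<bar> \<le> (C + 1) * 0"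
        by (rule LIMSEQ_le_const) (use \<omega> in \<open>auto simp: A_def\<close>)
      then show "F \<omega> = c" by simp
    qed (use \<open>C \<ge> 0\<close> in \<open>auto simp: A_def \<epsilon>_def\<close>)
    finally have prob_A: "(\<lambda>k. prob (A (\<epsilon> k))) \<longlonglongrightarrow> p" unfolding p_def .
    have "(\<lambda>k. N * (p - \<epsilon> k)) \<longlonglongrightarrow> N * (p - 0)" by (intro tendsto_intros \<epsilon>)
    moreover have "(\<lambda>k. 2 * real q + N * (prob (A (\<epsilon> k)) + \<epsilon> k)\<^sup>2) \<longlonglongrightarrow> 2 * real q + N * (p + 0)\<^sup>2"
      by (intro tendsto_intros \<epsilon> prob_A)
    ultimately have "N * (p - 0) \<le> 2 * real q + N * (p + 0)\<^sup>2"
      by (rule LIMSEQ_le) (intro exI allI impI step, simp add: \<epsilon>_def)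
    then show ?thesis by simp
  qed
  show ?thesis
  proof (rule ccontr)
    assume "\<not> p \<le> p\<^sup>2"
    then have pos: "p - p\<^sup>2 > 0" by simp
    \<comment> \<open>For such \<open>N\<close> the term \<open>2 * q\<close> is too small to
      compensate \<open>N * (p - p^2)\<close>, against \<open>N_bound\<close>.\<close>
    obtain N :: nat where N: "2 * q / (p - p\<^sup>2) < N" using reals_Archimedean2 by blast
    then have "0 < N" using pos by (cases "N = 0") (auto simp: divide_less_0_iff)
    moreover have "2 * q < N * (p - p\<^sup>2)" using N pos by (simp add: field_simps)
    ultimately show False using N_bound[of N] by (simp add: algebra_simps)
  qed
qed


section \<open>The law of the exponential mixture\<close>

text \<open>\<open>2 * B\<close> is exponential with parameter 1/2, and the density is a
  convolution: for \<open>x \<ge> 0\<close> the integrand reduces to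
  \<open>exp (- x) * exp (y / 2) / 2\<close> on \<open>[0, x]\<close>, with antiderivative
  \<open>exp (- x) * exp (y / 2)\<close>.\<close>

lemma distributed_exponential_add:
  assumes "prob_space M" and A: "distributed M lborel A (exponential_density 1)"
    and B: "distributed M lborel B (exponential_density 1)"
    and ind: "prob_space.indep_var M borel A borel B"
  shows "distributed M lborel (\<lambda>\<omega>. A \<omega> + 2 * B \<omega>) (\<lambda>x. ennreal (if x < 0 then 0 else exp (- x / 2) - exp (- x)))"
proof -
  interpret prob_space M by fact
  have "indep_var borel (id \<circ> A) borel ((\<lambda>x. 2 * x) \<circ> B)"
    using ind by (rule indep_var_compose) auto
  then have ind2: "indep_var borel A borel (\<lambda>\<omega>. 2 * B \<omega>)" by (simp add: comp_def)
  have "distributed M lborel (\<lambda>\<omega>. A \<omega> + 2 * B \<omega>)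
      (\<lambda>x. \<integral>\<^sup>+y. ennreal (exponential_density 1 (x - y)) * ennreal (exponential_density (1 / 2) y) \<partial>lborel)"
    using distributed_convolution[OF ind2 A erlang_distributed_mult_const[OF B]] by simp
  moreover have "(\<integral>\<^sup>+y. ennreal (exponential_density 1 (x - y)) * ennreal (exponential_density (1 / 2) y) \<partial>lborel)
      = ennreal (if x < 0 then 0 else exp (- x / 2) - exp (- x))" for x
  proof (cases "x < 0")
    case True
    then have "ennreal (exponential_density 1 (x - y)) * ennreal (exponential_density (1 / 2) y) = 0" for y
      by (cases "y < 0") (auto simp: exponential_density_def)
    then have "(\<integral>\<^sup>+y. ennreal (exponential_density 1 (x - y)) * ennreal (exponential_density (1 / 2) y) \<partial>lborel)
        = (\<integral>\<^sup>+(y::real). 0 \<partial>lborel)" by (simp only:)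
    then show ?thesis using True by simp
  next
    case False
    have "(\<integral>\<^sup>+y. ennreal (exponential_density 1 (x - y)) * ennreal (exponential_density (1 / 2) y) \<partial>lborel)
        = (\<integral>\<^sup>+y. ennreal (exp (- x) * exp (y / 2) / 2) * indicator {0..x} y \<partial>lborel)"
    proof (rule nn_integral_cong)
      fix y :: real
      have "exp (y - x) * exp (- (y / 2)) = exp (- x) * exp (y / 2)"
        unfolding exp_add[symmetric] by simp
      then show "ennreal (exponential_density 1 (x - y)) * ennreal (exponential_density (1 / 2) y)
          = ennreal (exp (- x) * exp (y / 2) / 2) * indicator {0..x} y"
        by (auto simp: exponential_density_def indicator_def ennreal_mult'[symmetric])
    qed
    also have "\<dots> = ennreal (exp (- x) * exp (x / 2) - exp (- x) * exp (0 / 2))"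
    proof (rule nn_integral_FTC_Icc[where F="\<lambda>y. exp (- x) * exp (y / 2)"])
      fix y :: real
      show "((\<lambda>y. exp (- x) * exp (y / 2)) has_real_derivative exp (- x) * exp (y / 2) / 2) (at y)"
        by (auto intro!: derivative_eq_intros)
    qed (use False in auto)
    also have "exp (- x) * exp (x / 2) = exp (- x / 2)"
      unfolding exp_add[symmetric] by simp
    finally show ?thesis using False by simp
  qed
  ultimately show ?thesis by simp
qed

lemma distr_of_bool_bernoulli:
  assumes "prob_space M" and \<beta>: "distr M borel \<beta> = distr (measure_pmf (bernoulli_pmf (1/2))) borel of_bool"
    and [measurable]: "\<beta> \<in> borel_measurable M"
  shows "measure M {\<omega> \<in> space M. \<beta> \<omega> = 0} = 1 / 2"
    and "measure M {\<omega> \<in> space M. \<beta> \<omega> = 1} = 1 / 2"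
    and "AE \<omega> in M. \<beta> \<omega> = 0 \<or> \<beta> \<omega> = 1"
    and "has_bochner_integral M \<beta> (1 / 2 :: real)"
proof -
  interpret prob_space M by fact
  have pr: "measure M {\<omega> \<in> space M. \<beta> \<omega> \<in> S} = measure (measure_pmf (bernoulli_pmf (1/2))) {b. of_bool b \<in> S}"
    if [measurable]: "S \<in> sets borel" for S :: "real set"
  proof -
    have "measure (distr M borel \<beta>) S = measure (distr (measure_pmf (bernoulli_pmf (1/2))) borel of_bool) S"
      using \<beta> by simp
    then show ?thesis by (simp add: measure_distr vimage_def Int_def conj_commute)
  qed
  have f: "{b. of_bool b \<in> {0::real}} = {False}" and t: "{b. of_bool b \<in> {1::real}} = {True}" by auto
  show "measure M {\<omega> \<in> space M. \<beta> \<omega> = 0} = 1 / 2" 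
    using pr[of "{0}"] unfolding f by (simp add: measure_pmf_single)
  show "measure M {\<omega> \<in> space M. \<beta> \<omega> = 1} = 1 / 2"
    using pr[of "{1}"] unfolding t by (simp add: measure_pmf_single)
  have "AE x in distr M borel \<beta>. x = 0 \<or> x = 1"
    unfolding \<beta> by (subst AE_distr_iff) auto
  then show "AE \<omega> in M. \<beta> \<omega> = 0 \<or> \<beta> \<omega> = 1"
    by (subst (asm) AE_distr_iff) auto
  have "has_bochner_integral (distr (measure_pmf (bernoulli_pmf (1/2))) borel of_bool) (\<lambda>x. x) (1 / 2 :: real)"
    by (subst has_bochner_integral_distr)
      (auto simp: has_bochner_integral_iff integrable_measure_pmf_finite)
  then show "has_bochner_integral M \<beta> (1 / 2 :: real)"
    unfolding \<beta>[symmetric] by (simp add: has_bochner_integral_iff integrable_distr_eq integral_distr)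
qed

text \<open>The variable is \<open>A\<close> where \<open>\<beta> = 0\<close> and
  \<open>A + 2 * B\<close> where \<open>\<beta> = 1\<close>; independence of \<open>\<beta>\<close>
  from each of these factors the two events, so the density is the average of theirs.\<close>

lemma distributed_exponential_mixture:
  assumes M: "prob_space M" and A: "distributed M lborel A (exponential_density 1)"
    and B: "distributed M lborel B (exponential_density 1)"
    and \<beta>: "distr M borel \<beta> = distr (measure_pmf (bernoulli_pmf (1/2))) borel of_bool"
    and [measurable]: "\<beta> \<in> borel_measurable M"
    and AB: "prob_space.indep_var M borel A borel B"
    and \<beta>A: "prob_space.indep_var M borel \<beta> borel A"
    and \<beta>AB: "prob_space.indep_var M borel \<beta> borel (\<lambda>\<omega>. A \<omega> + 2 * B \<omega>)"
  shows "distributed M lborel (\<lambda>\<omega>. A \<omega> + 2 * \<beta> \<omega> * B \<omega>) (exponential_density (1 / 2))"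
proof -
  interpret prob_space M by fact
  have [measurable]: "A \<in> borel_measurable M" "B \<in> borel_measurable M"
    using distributed_measurable[OF A] distributed_measurable[OF B] by auto
  define h :: "real \<Rightarrow> real" where "h = (\<lambda>x. if x < 0 then 0 else exp (- x / 2) - exp (- x))"
  have [measurable]: "h \<in> borel_measurable borel" unfolding h_def by measurable
  have h0: "h x \<ge> 0" for x by (simp add: h_def)
  have S: "distributed M lborel (\<lambda>\<omega>. A \<omega> + 2 * B \<omega>) (\<lambda>x. ennreal (h x))"
    unfolding h_def by (rule distributed_exponential_add[OF M A B AB])
  note \<beta>01 = distr_of_bool_bernoulli[OF M \<beta>]
  have "emeasure M {\<omega> \<in> space M. A \<omega> + 2 * \<beta> \<omega> * B \<omega> \<in> E}
      = \<integral>\<^sup>+x. ennreal (exponential_density (1 / 2) x) * indicator E x \<partial>lborel"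
    if [measurable]: "E \<in> sets borel" for E
  proof -
    have "prob {\<omega> \<in> space M. A \<omega> + 2 * \<beta> \<omega> * B \<omega> \<in> E}
        = prob ({\<omega> \<in> space M. \<beta> \<omega> \<in> {0} \<and> A \<omega> \<in> E} \<union> {\<omega> \<in> space M. \<beta> \<omega> \<in> {1} \<and> A \<omega> + 2 * B \<omega> \<in> E})"
      by (rule finite_measure_eq_AE) (use \<beta>01(3) in auto)
    also have "\<dots> = prob {\<omega> \<in> space M. \<beta> \<omega> \<in> {0} \<and> A \<omega> \<in> E}
        + prob {\<omega> \<in> space M. \<beta> \<omega> \<in> {1} \<and> A \<omega> + 2 * B \<omega> \<in> E}"
      by (rule finite_measure_Union) auto
    also have "\<dots> = 1 / 2 * prob {\<omega> \<in> space M. A \<omega> \<in> E} + 1 / 2 * prob {\<omega> \<in> space M. A \<omega> + 2 * B \<omega> \<in> E}"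
      using prob_indep_random_variable[OF \<beta>A, of "{0}" E] prob_indep_random_variable[OF \<beta>AB, of "{1}" E] \<beta>01(1,2)
      by simp
    finally have "emeasure M {\<omega> \<in> space M. A \<omega> + 2 * \<beta> \<omega> * B \<omega> \<in> E}
        = ennreal (1 / 2 * prob (A -` E \<inter> space M) + 1 / 2 * prob ((\<lambda>\<omega>. A \<omega> + 2 * B \<omega>) -` E \<inter> space M))"
      by (simp add: emeasure_eq_measure vimage_def Int_def conj_commute)
    also have "\<dots> = ennreal (1 / 2) * emeasure M (A -` E \<inter> space M)
        + ennreal (1 / 2) * emeasure M ((\<lambda>\<omega>. A \<omega> + 2 * B \<omega>) -` E \<inter> space M)"
    proof -
      have "(0::real) \<le> 1 / 2" by simp
      then show ?thesis
        by (subst ennreal_plus)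
          (simp_all only: emeasure_eq_measure ennreal_mult' mult_nonneg_nonneg measure_nonneg)
    qed
    also have "\<dots> = ennreal (1 / 2) * (\<integral>\<^sup>+x. ennreal (exponential_density 1 x) * indicator E x \<partial>lborel)
        + ennreal (1 / 2) * (\<integral>\<^sup>+x. ennreal (h x) * indicator E x \<partial>lborel)"
      by (simp add: distributed_emeasure[OF A] distributed_emeasure[OF S])
    also have "\<dots> = (\<integral>\<^sup>+x. ennreal (1 / 2) * (ennreal (exponential_density 1 x) * indicator E x)
        + ennreal (1 / 2) * (ennreal (h x) * indicator E x) \<partial>lborel)"
      by (subst nn_integral_add) (auto simp: nn_integral_cmult)
    also have "\<dots> = (\<integral>\<^sup>+x. ennreal (exponential_density (1 / 2) x) * indicator E x \<partial>lborel)"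
    proof (rule nn_integral_cong)
      fix x
      have "ennreal (1 / 2) * ennreal (exponential_density 1 x) + ennreal (1 / 2) * ennreal (h x)
          = ennreal (1 / 2 * exponential_density 1 x + 1 / 2 * h x)"
      proof -
        have half: "(0::real) \<le> 1 / 2" by simp
        show ?thesis using h0 exponential_density_nonneg[of 1]
          by (subst ennreal_plus)
            (simp_all only: ennreal_mult'[OF half] mult_nonneg_nonneg half zero_less_one)
      qed
      \<comment> \<open>The terms \<open>exp (- x)\<close> cancel and leave
        \<open>exp (- x / 2) / 2\<close> for nonnegative \<open>x\<close>.\<close>
      also have "1 / 2 * exponential_density 1 x + 1 / 2 * h x = exponential_density (1 / 2) x"
        by (simp add: exponential_density_def h_def field_simps)
      finally show "ennreal (1 / 2) * (ennreal (exponential_density 1 x) * indicator E x)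
        + ennreal (1 / 2) * (ennreal (h x) * indicator E x) = ennreal (exponential_density (1 / 2) x) * indicator E x"
        by (simp add: indicator_def)
    qed
    finally show ?thesis .
  qed
  then show ?thesis
    unfolding distributed_def
    by (auto intro!: measure_eqI simp: emeasure_distr emeasure_density vimage_def Int_def conj_commute)
qed

section \<open>Gamma laws\<close>

text \<open>The two densities differ only at 0, where the exponential density is 1 and
  \<open>gamma_density\<close> is 0; a point is Lebesgue null.\<close>

lemma gamma_law_1: "gamma_law 1 = density lborel (exponential_density 1)"
proof -
  have "AE x in lborel. x \<noteq> (0::real)" by (rule AE_lborel_singleton)
  then show ?thesis unfolding gamma_law_def
    by (intro density_cong) (auto simp: gamma_density_def exponential_density_def Gamma_1 elim!: eventually_mono)
qed

text \<open>A law with a density has no atoms, and an injective affine map creates none. This is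
  what separates \<open>Y\<close> from all Gamma laws.\<close>

lemma measure_affine_gamma_law_singleton:
  assumes "s > 0"
  shows "measure (distr (gamma_law a) borel (\<lambda>x. s * x + c)) {y} = 0"
proof -
  have [measurable]: "gamma_density a \<in> borel_measurable borel" unfolding gamma_density_def by measurable
  have "(\<lambda>x. s * x + c) -` {y} = {(y - c) / s}" using assms by (auto simp: field_simps)
  then have "measure (distr (gamma_law a) borel (\<lambda>x. s * x + c)) {y} = measure (gamma_law a) {(y - c) / s}"
    by (subst measure_distr) (auto simp: gamma_law_def)
  also have "\<dots> = 0"
    by (simp add: measure_def gamma_law_def emeasure_density nn_integral_indicator_singleton)
  finally show ?thesis .
qed

text \<open>Half of \<open>C\<close> is exponential with parameter 1, that is Gamma with shape 1,
  and doubling it again before subtracting 2 gives \<open>C - 2\<close>.\<close>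

lemma centered_gamma_law_2:
  assumes M: "prob_space M" and C: "distributed M lborel C (exponential_density (1 / 2))"
  shows "distr M borel (\<lambda>\<omega>. C \<omega> - 2) = centered_gamma_law 2"
proof -
  interpret prob_space M by fact
  have [measurable]: "C \<in> borel_measurable M" using distributed_measurable[OF C] by simp
  have "distributed M lborel (\<lambda>\<omega>. 1 / 2 * C \<omega>) (exponential_density 1)"
    using erlang_distributed_mult_const[OF C, of "1 / 2"] by simp
  then have "gamma_law 1 = distr M borel (\<lambda>\<omega>. 1 / 2 * C \<omega>)"
    unfolding gamma_law_1 distributed_def by (simp cong: distr_cong)
  then show ?thesis
    unfolding centered_gamma_law_def by (simp add: distr_distr comp_def)
qed


section \<open>Independence and moments of products\<close>

text \<open>Disjoint blocks of a mutually independent triple are independent. Taking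
  \<open>h\<close> to be \<open>fst\<close> or \<open>snd\<close> gives pairwise independence; other
  choices of \<open>h\<close> give \<open>Y\<close> and \<open>A + 2 * B\<close>.\<close>

lemma indep_list3:
  assumes "prob_space M" "prob_space.indep_vars M (\<lambda>_. borel) (\<lambda>i. [A, B, \<beta> :: 'a \<Rightarrow> real] ! i) {..<3}"
    and [measurable]: "h \<in> borel_measurable (borel \<Otimes>\<^sub>M borel)"
  shows "prob_space.indep_var M borel A borel (\<lambda>\<omega>. h (B \<omega>, \<beta> \<omega>) :: real)"
    and "prob_space.indep_var M borel \<beta> borel (\<lambda>\<omega>. h (A \<omega>, B \<omega>))"
proof -
  interpret prob_space M by fact
  have "indep_var borel ((\<lambda>f. f 0) \<circ> (\<lambda>\<omega>. restrict (\<lambda>i. ([A, B, \<beta>] ! i) \<omega>) {0}))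
      borel ((\<lambda>f. h (f 1, f 2)) \<circ> (\<lambda>\<omega>. restrict (\<lambda>i. ([A, B, \<beta>] ! i) \<omega>) {1, 2}))"
    by (rule indep_var_compose[OF indep_var_restrict[OF assms(2)]]) auto
  then show "indep_var borel A borel (\<lambda>\<omega>. h (B \<omega>, \<beta> \<omega>))"
    by (simp add: comp_def numeral_2_eq_2)
  have "indep_var borel ((\<lambda>f. f 2) \<circ> (\<lambda>\<omega>. restrict (\<lambda>i. ([A, B, \<beta>] ! i) \<omega>) {2}))
      borel ((\<lambda>f. h (f 0, f 1)) \<circ> (\<lambda>\<omega>. restrict (\<lambda>i. ([A, B, \<beta>] ! i) \<omega>) {0, 1}))"
    by (rule indep_var_compose[OF indep_var_restrict[OF assms(2)]]) auto
  then show "indep_var borel \<beta> borel (\<lambda>\<omega>. h (A \<omega>, B \<omega>))"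
    by (simp add: comp_def numeral_2_eq_2)
qed

lemma has_bochner_integral_indep_mult:
  fixes F G :: "'a \<Rightarrow> real"
  assumes "prob_space M" "prob_space.indep_var M borel F borel G"
    and "has_bochner_integral M F x" "has_bochner_integral M G y"
  shows "has_bochner_integral M (\<lambda>\<omega>. F \<omega> * G \<omega>) (x * y)"
proof -
  interpret prob_space M by fact
  show ?thesis
    using indep_var_integrable[OF assms(2)] indep_var_lebesgue_integral[OF assms(2)] assms(3,4)
    by (auto simp: has_bochner_integral_iff)
qed

lemma indep_var_power:
  fixes F G :: "'a \<Rightarrow> real"
  assumes "prob_space M" "prob_space.indep_var M borel F borel G"
  shows "prob_space.indep_var M borel (\<lambda>\<omega>. F \<omega> ^ m) borel (\<lambda>\<omega>. G \<omega> ^ n)"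
proof -
  interpret prob_space M by fact
  have "indep_var borel ((\<lambda>x. x ^ m) \<circ> F) borel ((\<lambda>x. x ^ n) \<circ> G)"
    by (rule indep_var_compose[OF assms(2)]) auto
  then show ?thesis by (simp add: comp_def)
qed

section \<open>The counterexample\<close>

theorem mainTheorem5:
  fixes M :: "'a measure" and A B \<beta> X Y Z :: "'a \<Rightarrow> real"
  assumes "prob_space M"
    and "distributed M lborel A (exponential_density 1)"
    and "distributed M lborel B (exponential_density 1)"
    and "distr M borel \<beta> = distr (measure_pmf (bernoulli_pmf (1/2))) borel of_bool"
    and "prob_space.indep_vars M (\<lambda>_. borel) (\<lambda>i. [A, B, \<beta>] ! i) {..<3}"
    and "X = (\<lambda>\<omega>. A \<omega> - 1)"
    and "Y = (\<lambda>\<omega>. 2 * \<beta> \<omega> * B \<omega> - 1)"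
    and "Z = (\<lambda>\<omega>. X \<omega> + Y \<omega>)"
  shows "prob_space.indep_var M borel X borel Y
    \<and> has_bochner_integral M X 0 \<and> has_bochner_integral M Y 0
    \<and> has_bochner_integral M (\<lambda>\<omega>. (X \<omega>)\<^sup>2) 1
    \<and> has_bochner_integral M (\<lambda>\<omega>. (Y \<omega>)\<^sup>2) 3
    \<and> cramer_conditions M X Y 2 (1/2) (3/2)
    \<and> (\<forall>T W q1 q2. wiener_process M T W \<and> q1 \<ge> 1 \<and> q2 \<ge> 1 \<longrightarrow>
          \<not> (X \<in> wiener_chaos M T W q1 \<and> Y \<in> wiener_chaos M T W q2))
    \<and> (\<forall>T W q. wiener_process M T W \<and> q \<ge> 1 \<longrightarrow> Y \<notin> wiener_chaos M T W q)
    \<and> distr M borel Z = centered_gamma_law 2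
    \<and> (\<forall>\<nu>>0. distr M borel Y \<noteq> centered_gamma_law \<nu>)
    \<and> (\<forall>a>0. \<forall>s>0. \<forall>c. distr M borel Y \<noteq> distr (gamma_law a) borel (\<lambda>x. s * x + c))"
proof -
  note M = assms(1) and A = assms(2) and B = assms(3) and \<beta> = assms(4) and ind = assms(5)
    and X = assms(6) and Y = assms(7) and Z = assms(8)
  interpret prob_space M by fact
  have [measurable]: "A \<in> borel_measurable M" "B \<in> borel_measurable M"
    using distributed_measurable[OF A] distributed_measurable[OF B] by auto
  \<comment> \<open>The hypothesis on the law of \<open>\<beta>\<close> is only an equation between
    measures; measurability is read off from independence.\<close>
  have \<beta>_meas[measurable]: "\<beta> \<in> borel_measurable M"
    using indep_var_rv1[OF indep_list3(2)[OF M ind, of fst]] by simp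
  note bernoulli = distr_of_bool_bernoulli[OF M \<beta> \<beta>_meas]
  have AB: "indep_var borel A borel B" using indep_list3(1)[OF M ind, of fst] by simp
  have \<beta>B: "indep_var borel \<beta> borel B" using indep_list3(2)[OF M ind, of snd] by simp
  have \<beta>A: "indep_var borel \<beta> borel A" using indep_list3(2)[OF M ind, of fst] by simp
  have \<beta>AB: "indep_var borel \<beta> borel (\<lambda>\<omega>. A \<omega> + 2 * B \<omega>)"
    using indep_list3(2)[OF M ind, of "\<lambda>(a, b). a + 2 * b"] by simp
  have AY: "indep_var borel A borel Y"
    using indep_list3(1)[OF M ind, of "\<lambda>(b, e). 2 * e * b - 1"] unfolding Y by simp
  have "indep_var borel ((\<lambda>x. x - 1) \<circ> A) borel (id \<circ> Y)"
    by (rule indep_var_compose[OF AY]) auto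
  then have XY: "indep_var borel X borel Y" unfolding X by (simp add: comp_def)
  have A1: "has_bochner_integral M A 1" and A2: "has_bochner_integral M (\<lambda>\<omega>. (A \<omega>)\<^sup>2) 2"
    using has_bochner_integral_erlang_ith_moment[OF _ A, of 1] has_bochner_integral_erlang_ith_moment[OF _ A, of 2]
    by (auto simp: fact_numeral)
  have B1: "has_bochner_integral M B 1" and B2: "has_bochner_integral M (\<lambda>\<omega>. (B \<omega>)\<^sup>2) 2"
    using has_bochner_integral_erlang_ith_moment[OF _ B, of 1] has_bochner_integral_erlang_ith_moment[OF _ B, of 2]
    by (auto simp: fact_numeral)
  \<comment> \<open>Almost surely \<open>\<beta>\<close> is 0 or 1 and equals its square.\<close>
  have \<beta>2: "has_bochner_integral M (\<lambda>\<omega>. (\<beta> \<omega>)\<^sup>2) (1 / 2)"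
    by (subst has_bochner_integral_cong_AE[of _ _ \<beta>]) (use bernoulli(3,4) in auto)
  have \<beta>B1: "has_bochner_integral M (\<lambda>\<omega>. \<beta> \<omega> * B \<omega>) (1 / 2)"
    using has_bochner_integral_indep_mult[OF M \<beta>B bernoulli(4) B1] by simp
  have \<beta>B2: "has_bochner_integral M (\<lambda>\<omega>. (\<beta> \<omega>)\<^sup>2 * (B \<omega>)\<^sup>2) 1"
    using has_bochner_integral_indep_mult[OF M indep_var_power[OF M \<beta>B] \<beta>2 B2] by simp
  have const: "has_bochner_integral M (\<lambda>_. c) c" for c :: real
    using prob_space by (simp add: has_bochner_integral_iff)
  have X1: "has_bochner_integral M X 0"
    using has_bochner_integral_diff[OF A1 const[of 1]] unfolding X by simp
  have Y1: "has_bochner_integral M Y 0"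
    using has_bochner_integral_diff[OF has_bochner_integral_mult_right[OF \<beta>B1, of 2] const[of 1]]
    unfolding Y by (simp add: mult_ac)
  have X2: "has_bochner_integral M (\<lambda>\<omega>. (X \<omega>)\<^sup>2) 1"
    using has_bochner_integral_add[OF has_bochner_integral_diff[OF A2 has_bochner_integral_mult_right[OF A1, of 2]] const[of 1]]
    unfolding X by (simp add: power2_eq_square algebra_simps)
  \<comment> \<open>Expanding the square gives 4 * 1 - 4 * (1/2) + 1 = 3.\<close>
  have Y2: "has_bochner_integral M (\<lambda>\<omega>. (Y \<omega>)\<^sup>2) 3"
    using has_bochner_integral_add[OF has_bochner_integral_diff[OF has_bochner_integral_mult_right[OF \<beta>B2, of 4]
        has_bochner_integral_mult_right[OF \<beta>B1, of 4]] const[of 1]]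
    unfolding Y by (simp add: power2_eq_square algebra_simps)
  \<comment> \<open>The cross term vanishes, as \<open>X\<close> and \<open>Y\<close> are
    independent and centered; the value 4 is twice the parameter 2.\<close>
  have XY2: "has_bochner_integral M (\<lambda>\<omega>. (X \<omega> + Y \<omega>)\<^sup>2) 4"
    using has_bochner_integral_add[OF has_bochner_integral_add[OF X2
          has_bochner_integral_mult_right[OF has_bochner_integral_indep_mult[OF M XY X1 Y1], of 2]] Y2]
    by (simp add: power2_sum algebra_simps)
  have law: "distr M borel (\<lambda>\<omega>. X \<omega> + Y \<omega>) = centered_gamma_law 2"
    using centered_gamma_law_2[OF M distributed_exponential_mixture[OF M A B \<beta> \<beta>_meas AB \<beta>A \<beta>AB]]
    unfolding X Y by (simp add: algebra_simps)
  have [measurable]: "Y \<in> borel_measurable M" unfolding Y by measurable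
  \<comment> \<open>Since \<open>B\<close> almost surely does not vanish, \<open>Y = -1\<close>
    happens exactly when \<open>\<beta> = 0\<close>, up to a null set. This is the atom of mass
    1/2.\<close>
  have "AE \<omega> in M. B \<omega> \<noteq> 0"
    using AE_lborel_singleton[of "0::real"] by (subst distributed_AE2[OF B]) auto
  then have "measure M {\<omega> \<in> space M. Y \<omega> = -1} = measure M {\<omega> \<in> space M. \<beta> \<omega> = 0}"
    by (intro finite_measure_eq_AE) (auto simp: Y elim!: eventually_mono)
  then have atom: "measure M {\<omega> \<in> space M. Y \<omega> = -1} = 1 / 2"
    using bernoulli(1) by simp
  then have "measure (distr M borel Y) {-1} = 1 / 2"
    by (simp add: measure_distr vimage_def Int_def conj_commute)
  then have not_gamma: "distr M borel Y \<noteq> distr (gamma_law a) borel (\<lambda>x. s * x + c)" if "s > 0" for a s c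
    using measure_affine_gamma_law_singleton[OF that, of a c "-1"] by auto
  have not_centered: "distr M borel Y \<noteq> centered_gamma_law \<nu>" for \<nu>
    using not_gamma[of 2 "\<nu> / 2" "- \<nu>"] by (simp add: centered_gamma_law_def)
  \<comment> \<open>The zero-one law would give 1/2 \<le> 1/4.\<close>
  have not_chaos: "Y \<notin> wiener_chaos M T W q" if "wiener_process M T W" for T W q
    using wiener_chaos_atom[OF that, of Y q "-1"] atom by (auto simp: power2_eq_square)
  have "cramer_conditions M X Y 2 (1/2) (3/2)"
    using XY X2 Y2 XY2 law by (simp add: cramer_conditions_def)
  then show ?thesis
    using XY X1 Y1 X2 Y2 law not_chaos not_gamma not_centered unfolding Z by blast
qed

end
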